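(* The family of timelike future-directed curves in $AdS$ horizontal with respect to $\mathcal D=\operatorname{span}\{T,X\}$ contains horizontal timelike future-directed geodesics $c(s)$ (corresponding to vanishing Lagrange multiplier $\lambda\equiv0$) with the following properties. 1. The length $|\dot c|$ is constant along the geodesic. 2. The inner products $\langle T,\dot c\rangle=\alpha$, $\langle X,\dot c\rangle=\beta$, $\langle Y,\dot c\rangle=0$ are constant along the geodesic. 3. The hyperbolic angle between the horizontal time vector field $T$ and the velocity vector $\dot c$ is constant along the geodesic.
   Context: $\mathbb R^{2,2}$ is $\mathbb R^4$ with $\langle x,y\rangle=-x_1y_1-x_2y_2+x_3y_3+x_4y_4$, and $AdS=\{x\in\mathbb R^4:\langle x,x\rangle=-1\}$. The vector fields $T(x)=(-x_2,x_1,x_4,-x_3)$, $X(x)=(x_3,x_4,x_1,x_2)$, $Y(x)=(x_4,-x_3,-x_2,x_1)$ form an orthogonal basis of each tangent space of $AdS$ with $\langle T,T\rangle=-1$, $\langle X,X\rangle=\langle Y,Y\rangle=1$. A curve $c$ in $AdS$ is horizontal if $\dot c\in\operatorname{span}\{T,X\}$; equivalently $\langle \dot c,Y\rangle=0$. It is timelike if $\langle\dot c,\dot c\rangle<0$ everywhere, and a timelike curve is future-directed if $\langle\dot c,T\rangle<0$. Put $|v|=|\langle v,v\rangle|^{1/2}$. For timelike $v,w$ with $\langle v,w\rangle<0$ the hyperbolic angle between $v$ and $w$ is the unique $\vartheta\ge 0$ with $\langle v,w\rangle=-|v||w|\cosh\vartheta$. For a curve $c$ in $AdS$ put $\alpha=\langle\dot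 c,T(c)\rangle$, $\beta=\langle\dot c,X(c)\rangle$. A geodesic here means a smooth horizontal curve on $AdS$ which, for some function $\lambda(s)$ (the Lagrange multiplier), satisfies the Euler–Lagrange equations $\frac{d}{ds}\frac{\partial L}{\partial\dot c}=\frac{\partial L}{\partial c}$ on $AdS$ of the Lagrangian $L(c,\dot c)=\tfrac12(-\alpha^2+\beta^2)+\lambda(s)\langle Y(c),\dot c\rangle$, i.e. an extremal of the action $\tfrac12\int_0^1(-\alpha^2+\beta^2)\,ds$ under the constraint $\langle Y,\dot c\rangle=0$. *)

theory Defs
  imports "HOL-Analysis.Analysis"
begin

definition pip :: "real^4 \<Rightarrow> real^4 \<Rightarrow> real" where
  "pip x y = - x$1 * y$1 - x$2 * y$2 + x$3 * y$3 + x$4 * y$4"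

definition pnorm :: "real^4 \<Rightarrow> real" where
  "pnorm v = sqrt \<bar>pip v v\<bar>"

definition AdS :: "(real^4) set" where
  "AdS = {x. pip x x = -1}"

text \<open>The tangent space of \<^const>\<open>AdS\<close> at \<open>x\<close>, i.e. the kernel of the differential of
  \<open>x \<mapsto> pip x x\<close>.\<close>

definition AdS_tangent :: "real^4 \<Rightarrow> (real^4) set" where
  "AdS_tangent x = {w. pip x w = 0}"

definition fieldT :: "real^4 \<Rightarrow> real^4" where
  "fieldT x = vector [- x$2, x$1, x$4, - x$3]"

definition fieldX :: "real^4 \<Rightarrow> real^4" where
  "fieldX x = vector [x$3, x$4, x$1, x$2]"

definition fieldY :: "real^4 \<Rightarrow> real^4" where
  "fieldY x = vector [x$4, - x$3, - x$2, x$1]"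

text \<open>Curves are parametrized by an interval \<open>I\<close> with nonempty interior; at an endpoint that belongs
  to \<open>I\<close> the derivative is one-sided.\<close>

definition velocity :: "real set \<Rightarrow> (real \<Rightarrow> real^4) \<Rightarrow> real \<Rightarrow> real^4" where
  "velocity I c s = vector_derivative c (at s within I)"

definition AdS_curve :: "real set \<Rightarrow> (real \<Rightarrow> real^4) \<Rightarrow> bool" where
  "AdS_curve I c \<longleftrightarrow> c differentiable_on I \<and> c ` I \<subseteq> AdS"

definition horizontal :: "real set \<Rightarrow> (real \<Rightarrow> real^4) \<Rightarrow> bool" where
  "horizontal I c \<longleftrightarrow> (\<forall>s\<in>I. velocity I c s \<in> span {fieldT (c s), fieldX (c s)})"

definition timelike :: "real set \<Rightarrow> (real \<Rightarrow> real^4) \<Rightarrow> bool" where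
  "timelike I c \<longleftrightarrow> (\<forall>s\<in>I. pip (velocity I c s) (velocity I c s) < 0)"

definition future_directed :: "real set \<Rightarrow> (real \<Rightarrow> real^4) \<Rightarrow> bool" where
  "future_directed I c \<longleftrightarrow> (\<forall>s\<in>I. pip (velocity I c s) (fieldT (c s)) < 0)"

definition horizontal_timelike_fd_curves :: "real set \<Rightarrow> (real \<Rightarrow> real^4) set" where
  "horizontal_timelike_fd_curves I =
     {c. AdS_curve I c \<and> horizontal I c \<and> timelike I c \<and> future_directed I c}"

definition is_hyperbolic_angle :: "real^4 \<Rightarrow> real^4 \<Rightarrow> real \<Rightarrow> bool" where
  "is_hyperbolic_angle v w \<theta> \<longleftrightarrow>
     pip v v < 0 \<and> pip w w < 0 \<and> pip v w < 0 \<and>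
     \<theta> \<ge> 0 \<and> pip v w = - pnorm v * pnorm w * cosh \<theta>"

definition hyperbolic_angle :: "real^4 \<Rightarrow> real^4 \<Rightarrow> real" where
  "hyperbolic_angle v w = (THE \<theta>. is_hyperbolic_angle v w \<theta>)"

text \<open>\<open>D k\<close> is the \<open>k\<close>-th derivative of \<open>c\<close>.\<close>

definition smooth_curve :: "real set \<Rightarrow> (real \<Rightarrow> real^4) \<Rightarrow> bool" where
  "smooth_curve I c \<longleftrightarrow> (\<exists>D :: nat \<Rightarrow> real \<Rightarrow> real^4. D 0 = c \<and>
     (\<forall>k. \<forall>s\<in>I. (D k has_vector_derivative D (Suc k) s) (at s within I)))"

text \<open>The Lagrangian at parameter \<open>s\<close>, position \<open>x\<close> and velocity \<open>v\<close>, with multiplier \<open>l\<close>.\<close>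

definition lagrangian :: "(real \<Rightarrow> real) \<Rightarrow> real \<Rightarrow> real^4 \<Rightarrow> real^4 \<Rightarrow> real" where
  "lagrangian l s x v =
     (1/2) * (- (pip v (fieldT x))\<^sup>2 + (pip v (fieldX x))\<^sup>2) + l s * pip (fieldY x) v"

text \<open>The equations \<open>d/ds (\<partial>L/\<partial>v) = \<partial>L/\<partial>x\<close> along \<open>c\<close>, on \<^const>\<open>AdS\<close>: both sides are covectors on
  \<open>\<real>\<^sup>4\<close>, and they are compared on vectors \<open>w\<close> tangent to \<^const>\<open>AdS\<close>, since only variations inside
  \<^const>\<open>AdS\<close> are admissible. (As equations between covectors on all of \<open>\<real>\<^sup>4\<close> they would have no
  timelike horizontal solution: for \<open>l = 0\<close> the component normal to \<^const>\<open>AdS\<close> does not vanish.)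
  The vector \<open>w\<close> is held fixed while differentiating in the curve parameter.\<close>

definition euler_lagrange_AdS ::
  "real set \<Rightarrow> (real \<Rightarrow> real^4 \<Rightarrow> real^4 \<Rightarrow> real) \<Rightarrow> (real \<Rightarrow> real^4) \<Rightarrow> bool" where
  "euler_lagrange_AdS I L c \<longleftrightarrow> (\<forall>s\<in>I. \<forall>w\<in>AdS_tangent (c s).
     ((\<lambda>t. frechet_derivative (\<lambda>v. L t (c t) v) (at (velocity I c t)) w)
        has_real_derivative
      frechet_derivative (\<lambda>x. L s x (velocity I c s)) (at (c s)) w) (at s within I))"

definition geodesic_with_multiplier ::
  "real set \<Rightarrow> (real \<Rightarrow> real) \<Rightarrow> (real \<Rightarrow> real^4) \<Rightarrow> bool" where
  "geodesic_with_multiplier I l c \<longleftrightarrow>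
     smooth_curve I c \<and> AdS_curve I c \<and> horizontal I c \<and>
     euler_lagrange_AdS I (lagrangian l) c"

end

theory Submission
  imports Defs
begin

text \<open>The maps \<^const>\<open>fieldT\<close>, \<^const>\<open>fieldX\<close>, \<^const>\<open>fieldY\<close> are linear, skew-adjoint for
  \<^const>\<open>pip\<close>, and satisfy \<open>T\<^sup>2 = -1\<close>, \<open>X\<^sup>2 = 1\<close>, \<open>XT = Y = -TX\<close>. Hence testing the Euler--Lagrange
  equations with \<open>l = 0\<close> on \<open>w = T(c)\<close> and \<open>w = X(c)\<close> leaves, besides \<open>\<alpha>'\<close> respectively \<open>\<beta>'\<close>, only
  multiples of \<open>\<langle>c, c'\<rangle>\<close> and \<open>\<langle>Y(c), c'\<rangle>\<close>, which vanish by horizontality. So \<open>\<alpha>\<close> and \<open>\<beta>\<close> are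
  constant, and with them \<open>\<langle>c', c'\<rangle> = -\<alpha>\<^sup>2 + \<beta>\<^sup>2\<close> and the angle between \<open>T\<close> and \<open>c'\<close>. The integral
  curve \<open>(cos s, sin s, 0, 0)\<close> of \<open>T\<close> shows that such geodesics exist.\<close>

section \<open>Algebra of \<open>pip\<close> and of the frame T, X, Y\<close>

lemma vector_4 [simp]:
  "(vector [w, x, y, z] :: 'a::zero ^ 4) $ 1 = w"
  "(vector [w, x, y, z] :: 'a::zero ^ 4) $ 2 = x"
  "(vector [w, x, y, z] :: 'a::zero ^ 4) $ 3 = y"
  "(vector [w, x, y, z] :: 'a::zero ^ 4) $ 4 = z"
  by (simp_all add: vector_def)

lemma bounded_bilinear_pip: "bounded_bilinear pip"
  unfolding bilinear_conv_bounded_bilinear[symmetric] bilinear_def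
  by (auto intro!: linearI simp: pip_def algebra_simps)

lemma bounded_linear_fieldT: "bounded_linear fieldT"
  unfolding linear_conv_bounded_linear[symmetric]
  by (auto intro!: linearI simp: fieldT_def vec_eq_iff forall_4)

lemma bounded_linear_fieldX: "bounded_linear fieldX"
  unfolding linear_conv_bounded_linear[symmetric]
  by (auto intro!: linearI simp: fieldX_def vec_eq_iff forall_4)

lemma bounded_linear_fieldY: "bounded_linear fieldY"
  unfolding linear_conv_bounded_linear[symmetric]
  by (auto intro!: linearI simp: fieldY_def vec_eq_iff forall_4)

lemmas pip_simps =
  bounded_bilinear.add_left[OF bounded_bilinear_pip]
  bounded_bilinear.add_right[OF bounded_bilinear_pip]
  bounded_bilinear.scaleR_left[OF bounded_bilinear_pip]
  bounded_bilinear.scaleR_right[OF bounded_bilinear_pip]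
  bounded_bilinear.minus_left[OF bounded_bilinear_pip]
  bounded_bilinear.minus_right[OF bounded_bilinear_pip]

lemma pip_commute: "pip v w = pip w v"
  by (simp add: pip_def mult.commute)

lemma field_compositions:
  "fieldT (fieldT x) = - x" "fieldX (fieldX x) = x"
  "fieldT (fieldX x) = - fieldY x" "fieldX (fieldT x) = fieldY x"
  by (simp_all add: fieldT_def fieldX_def fieldY_def vec_eq_iff forall_4)

lemma pip_field_skew:
  "pip (fieldT x) y = - pip x (fieldT y)"
  "pip (fieldX x) y = - pip x (fieldX y)"
  by (simp_all add: pip_def fieldT_def fieldX_def)

lemma pip_frame:
  "pip (fieldT x) (fieldT x) = pip x x"
  "pip (fieldX x) (fieldX x) = - pip x x"
  "pip (fieldT x) (fieldX x) = 0" "pip (fieldX x) (fieldT x) = 0"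
  "pip (fieldY x) (fieldT x) = 0" "pip (fieldY x) (fieldX x) = 0"
  "pip x (fieldT x) = 0" "pip x (fieldX x) = 0" "pip x (fieldY x) = 0"
  by (simp_all add: pip_def fieldT_def fieldX_def fieldY_def)

text \<open>On AdS the fields T and X are orthogonal with squares -1 and 1, so pairing with them
  reads off the coefficients; the timelike square of T causes the minus sign.\<close>

lemma horizontal_vector_decomposition:
  assumes "x \<in> AdS" "v \<in> span {fieldT x, fieldX x}"
  shows "v = - pip v (fieldT x) *\<^sub>R fieldT x + pip v (fieldX x) *\<^sub>R fieldX x"
proof -
  obtain p where "v - p *\<^sub>R fieldT x \<in> span {fieldX x}"
    using assms(2) span_breakdown_eq by blast
  then obtain q where "v - p *\<^sub>R fieldT x = q *\<^sub>R fieldX x"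
    by (auto simp: span_singleton)
  then have v: "v = p *\<^sub>R fieldT x + q *\<^sub>R fieldX x"
    by (simp add: algebra_simps)
  have "pip v (fieldT x) = - p" "pip v (fieldX x) = q"
    using assms(1) by (simp_all add: v pip_simps pip_frame AdS_def)
  then show ?thesis using v by simp
qed

text \<open>T and X are orthogonal to the position vector and to Y, hence so are their combinations.
  The last claim is the Pythagorean formula in the Lorentzian plane spanned by T and X.\<close>

lemma horizontal_vector_pip:
  assumes "x \<in> AdS" "v \<in> span {fieldT x, fieldX x}"
  shows "pip x v = 0" "pip (fieldY x) v = 0"
    "pip v v = - (pip v (fieldT x))\<^sup>2 + (pip v (fieldX x))\<^sup>2"
proof -
  define p q where "p = - pip v (fieldT x)" and "q = pip v (fieldX x)"
  have v: "v = p *\<^sub>R fieldT x + q *\<^sub>R fieldX x"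
    unfolding p_def q_def by (rule horizontal_vector_decomposition[OF assms])
  show "pip x v = 0" "pip (fieldY x) v = 0"
    by (simp_all add: v pip_simps pip_frame)
  have "pip v v = - p\<^sup>2 + q\<^sup>2"
    using assms(1) by (simp add: v pip_simps pip_frame AdS_def power2_eq_square)
  then show "pip v v = - (pip v (fieldT x))\<^sup>2 + (pip v (fieldX x))\<^sup>2"
    by (simp add: p_def q_def)
qed

section \<open>Partial derivatives of the Lagrangian\<close>

lemma frechet_derivative_lagrangian_velocity:
  "frechet_derivative (\<lambda>v. lagrangian l s x v) (at v) w =
     - pip v (fieldT x) * pip w (fieldT x) + pip v (fieldX x) * pip w (fieldX x)
     + l s * pip (fieldY x) w"
proof -
  note [derivative_intros] =
    bounded_bilinear.FDERIV[OF bounded_bilinear_pip]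
  have deriv: "((\<lambda>v. lagrangian l s x v) has_derivative
    (\<lambda>w. - pip v (fieldT x) * pip w (fieldT x) + pip v (fieldX x) * pip w (fieldX x)
     + l s * pip (fieldY x) w)) (at v)"
    unfolding lagrangian_def
    by (auto intro!: derivative_eq_intros
        simp: bounded_bilinear.zero_right[OF bounded_bilinear_pip]
          bounded_bilinear.zero_left[OF bounded_bilinear_pip] algebra_simps)
  show ?thesis by (simp only: frechet_derivative_at[OF deriv, symmetric])
qed

text \<open>With v fixed, x enters only through the fields; these are linear and hence their own
  differentials.\<close>

lemma frechet_derivative_lagrangian_position:
  "frechet_derivative (\<lambda>x. lagrangian l s x v) (at x) w =
     - pip v (fieldT x) * pip v (fieldT w) + pip v (fieldX x) * pip v (fieldX w)
     + l s * pip (fieldY w) v"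
proof -
  note [derivative_intros] =
    bounded_bilinear.FDERIV[OF bounded_bilinear_pip]
    bounded_linear.has_derivative[OF bounded_linear_fieldT]
    bounded_linear.has_derivative[OF bounded_linear_fieldX]
    bounded_linear.has_derivative[OF bounded_linear_fieldY]
  have deriv: "((\<lambda>x. lagrangian l s x v) has_derivative
    (\<lambda>w. - pip v (fieldT x) * pip v (fieldT w) + pip v (fieldX x) * pip v (fieldX w)
     + l s * pip (fieldY w) v)) (at x)"
    unfolding lagrangian_def
    by (auto intro!: derivative_eq_intros
        simp: bounded_bilinear.zero_right[OF bounded_bilinear_pip]
          bounded_bilinear.zero_left[OF bounded_bilinear_pip] algebra_simps)
  show ?thesis by (simp only: frechet_derivative_at[OF deriv, symmetric])
qed

section \<open>One-sided derivatives on intervals\<close>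

lemma at_within_interval_neq_bot:
  fixes I :: "real set"
  assumes "is_interval I" "interior I \<noteq> {}" "s \<in> I"
  shows "at s within I \<noteq> bot"
proof -
  \<comment> \<open>A singleton has empty interior, and a connected set with more than one point has
    no isolated points. This makes derivatives within I unique, also at endpoints.\<close>
  have "I \<noteq> {s}" using assms(2) by auto
  then have "s islimpt I"
    using connected_imp_perfect assms(1,3) is_interval_connected by blast
  then show ?thesis by (simp add: trivial_limit_within)
qed

lemma velocity_eqI:
  assumes "is_interval I" "interior I \<noteq> {}" "s \<in> I"
    and "(c has_vector_derivative v) (at s within I)"
  shows "velocity I c s = v"
  unfolding velocity_def
  by (rule vector_derivative_within[OF at_within_interval_neq_bot[OF assms(1-3)] assms(4)])

section \<open>Existence and uniqueness of hyperbolic angles\<close>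

lemma ex1_is_hyperbolic_angle:
  assumes "pip v v < 0" "pip w w < 0" "pip v w < 0" "pip v w \<le> - pnorm v * pnorm w"
  shows "\<exists>!\<theta>. is_hyperbolic_angle v w \<theta>"
proof (rule ex_ex1I)
  define N r where "N = pnorm v * pnorm w" and "r = - pip v w / N"
  have "N > 0"
    using assms(1,2) by (simp add: N_def pnorm_def)
  \<comment> \<open>This is where the reverse Cauchy-Schwarz hypothesis enters. In signature (2,2)
    it does not follow from the sign conditions: v = (1,0,0,0) and w = (1,1,0,0) violate it.\<close>
  then have "1 \<le> r" "pip v w = - N * r"
    using assms(4) by (simp_all add: r_def N_def[symmetric] divide_le_eq)
  then have "is_hyperbolic_angle v w (arcosh r)"
    using assms(1-3) by (simp add: is_hyperbolic_angle_def cosh_arcosh_real N_def)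
  then show "\<exists>\<theta>. is_hyperbolic_angle v w \<theta>" ..
next
  fix \<theta> \<eta>
  assume "is_hyperbolic_angle v w \<theta>" "is_hyperbolic_angle v w \<eta>"
  moreover have "pnorm v \<noteq> 0" "pnorm w \<noteq> 0"
    using assms by (simp_all add: pnorm_def)
  ultimately have "cosh \<theta> = cosh \<eta>" "\<theta> \<ge> 0" "\<eta> \<ge> 0"
    by (simp_all add: is_hyperbolic_angle_def)
  then show "\<theta> = \<eta>"
    using cosh_real_nonneg_le_iff[of \<theta> \<eta>] cosh_real_nonneg_le_iff[of \<eta> \<theta>] by simp
qed

text \<open>Within the plane of T and X the reverse Cauchy-Schwarz inequality does hold: T is a unit
  vector and |<v,v>| = \<alpha>^2 - \<beta>^2 \<le> \<alpha>^2 with \<alpha> = <v,T>.\<close>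

lemma hyperbolic_angle_fieldT:
  assumes "x \<in> AdS" "v \<in> span {fieldT x, fieldX x}" "pip v v < 0" "pip v (fieldT x) < 0"
  shows "\<exists>!\<theta>. is_hyperbolic_angle (fieldT x) v \<theta>"
proof (rule ex1_is_hyperbolic_angle)
  have TT: "pip (fieldT x) (fieldT x) = -1"
    using assms(1) by (simp add: pip_frame AdS_def)
  then show "pip (fieldT x) (fieldT x) < 0" by simp
  show "pip (fieldT x) v < 0" using assms(4) by (simp add: pip_commute)
  have "\<bar>pip v v\<bar> \<le> (pip v (fieldT x))\<^sup>2"
    using horizontal_vector_pip(3)[OF assms(1,2)] assms(3) by simp
  then have "pnorm v \<le> \<bar>pip v (fieldT x)\<bar>"
    unfolding pnorm_def using real_sqrt_le_mono by fastforce
  moreover have "pnorm (fieldT x) = 1" by (simp add: pnorm_def TT)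
  ultimately show "pip (fieldT x) v \<le> - pnorm (fieldT x) * pnorm v"
    using assms(4) by (simp add: pip_commute)
qed fact

section \<open>Conservation of \<alpha> and \<beta> along geodesics\<close>

lemma geodesic_inner_products_constant:
  fixes I :: "real set"
  assumes I: "is_interval I" "interior I \<noteq> {}"
    and geo: "geodesic_with_multiplier I (\<lambda>_. 0) c"
  shows "(\<lambda>s. pip (velocity I c s) (fieldT (c s))) constant_on I"
    and "(\<lambda>s. pip (velocity I c s) (fieldX (c s))) constant_on I"
proof -
  define v where "v = velocity I c"
  obtain D where D: "D 0 = c"
    "\<And>k s. s \<in> I \<Longrightarrow> (D k has_vector_derivative D (Suc k) s) (at s within I)"
    using geo by (auto simp: geodesic_with_multiplier_def smooth_curve_def)
  have vD: "v s = D 1 s" if "s \<in> I" for s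
    unfolding v_def using velocity_eqI[OF I that] D(2)[OF that, of 0] D(1) by simp
  have dc: "(c has_vector_derivative v s) (at s within I)" if "s \<in> I" for s
    using D(2)[OF that, of 0] D(1) vD[OF that] by simp
  have dv: "(v has_vector_derivative D 2 s) (at s within I)" if "s \<in> I" for s
    using has_vector_derivative_transform[OF that vD D(2)[OF that, of 1]]
    by (simp add: numeral_2_eq_2)
  note pip_deriv = bounded_bilinear.has_vector_derivative[OF bounded_bilinear_pip]
  define \<alpha> \<beta> where "\<alpha> = (\<lambda>t. pip (v t) (fieldT (c t)))"
    and "\<beta> = (\<lambda>t. pip (v t) (fieldX (c t)))"
  have d0: "(\<alpha> has_real_derivative 0) (at s within I) \<and> (\<beta> has_real_derivative 0) (at s within I)"
    if s: "s \<in> I" for s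
  proof -
    have cA: "c s \<in> AdS" and hor: "v s \<in> span {fieldT (c s), fieldX (c s)}"
      using geo s by (auto simp: geodesic_with_multiplier_def AdS_curve_def horizontal_def v_def)
    have EL: "((\<lambda>t. - \<alpha> t * pip w (fieldT (c t)) + \<beta> t * pip w (fieldX (c t)))
        has_real_derivative - \<alpha> s * pip (v s) (fieldT w) + \<beta> s * pip (v s) (fieldX w))
        (at s within I)" if "w \<in> AdS_tangent (c s)" for w
      using geo s that
      by (simp add: geodesic_with_multiplier_def euler_lagrange_AdS_def \<alpha>_def \<beta>_def v_def
          frechet_derivative_lagrangian_velocity frechet_derivative_lagrangian_position)
    have dT: "((\<lambda>t. fieldT (c t)) has_vector_derivative fieldT (v s)) (at s within I)"
      and dX: "((\<lambda>t. fieldX (c t)) has_vector_derivative fieldX (v s)) (at s within I)"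
      using bounded_linear.has_vector_derivative[OF bounded_linear_fieldT dc[OF s]]
        bounded_linear.has_vector_derivative[OF bounded_linear_fieldX dc[OF s]] by auto
    \<comment> \<open>The equations in \<open>EL\<close> only differentiate combinations of \<alpha>
      and \<beta>; that each is differentiable by itself comes from the smoothness of c.\<close>
    obtain a b where a: "(\<alpha> has_real_derivative a) (at s within I)"
      and b: "(\<beta> has_real_derivative b) (at s within I)"
      using pip_deriv[OF dv[OF s] dT] pip_deriv[OF dv[OF s] dX]
      unfolding \<alpha>_def \<beta>_def has_real_derivative_iff_has_vector_derivative by blast
    \<comment> \<open>The product rule, with w held fixed, gives a second expression for the
      derivative prescribed by \<open>EL\<close>; uniqueness of derivatives within I equates the
      two.\<close>
    have EL_eq: "- \<alpha> s * pip w (fieldT (v s)) - a * pip w (fieldT (c s))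
        + (\<beta> s * pip w (fieldX (v s)) + b * pip w (fieldX (c s)))
        = - \<alpha> s * pip (v s) (fieldT w) + \<beta> s * pip (v s) (fieldX w)"
      if w: "w \<in> AdS_tangent (c s)" for w
    proof (rule vector_derivative_unique_within[OF at_within_interval_neq_bot[OF I s]])
      show "((\<lambda>t. - \<alpha> t * pip w (fieldT (c t)) + \<beta> t * pip w (fieldX (c t))) has_vector_derivative
        - \<alpha> s * pip w (fieldT (v s)) - a * pip w (fieldT (c s))
        + (\<beta> s * pip w (fieldX (v s)) + b * pip w (fieldX (c s)))) (at s within I)"
        using bounded_linear.has_vector_derivative[OF
            bounded_bilinear.bounded_linear_right[OF bounded_bilinear_pip, of w] dT]
          bounded_linear.has_vector_derivative[OF
            bounded_bilinear.bounded_linear_right[OF bounded_bilinear_pip, of w] dX] a b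
        unfolding has_real_derivative_iff_has_vector_derivative[symmetric]
        by (auto intro!: derivative_eq_intros)
    qed (use EL[OF w] in \<open>simp add: has_real_derivative_iff_has_vector_derivative\<close>)
    note orth = horizontal_vector_pip(1,2)[OF cA hor]
    have orth': "pip (v s) (c s) = 0" "pip (v s) (fieldY (c s)) = 0"
      using orth by (simp_all add: pip_commute)
    \<comment> \<open>Instantiated at u = \<open>v s\<close>, this moves the field from the velocity
      onto w, where \<open>field_compositions\<close> yields c or Y(c) up to sign; both are
      orthogonal to the velocity.\<close>
    have skew: "pip w (fieldT u) = - pip (fieldT w) u" "pip w (fieldX u) = - pip (fieldX w) u"
      for w u by (simp_all add: pip_field_skew)
    have "a = 0"
      using EL_eq[of "fieldT (c s)"] cA
      by (simp add: AdS_tangent_def pip_frame AdS_def skew[of _ "v s"] field_compositions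
          pip_simps orth orth')
    moreover have "b = 0"
      using EL_eq[of "fieldX (c s)"] cA
      by (simp add: AdS_tangent_def pip_frame AdS_def skew[of _ "v s"] field_compositions
          pip_simps orth orth')
    ultimately show ?thesis using a b by simp
  qed
  have "convex I" using I(1) by (simp add: is_interval_convex)
  then have "\<alpha> constant_on I" "\<beta> constant_on I"
    unfolding constant_on_def
    using has_field_derivative_zero_constant[of I \<alpha>] has_field_derivative_zero_constant[of I \<beta>] d0
    by blast+
  then show "(\<lambda>s. pip (velocity I c s) (fieldT (c s))) constant_on I"
    "(\<lambda>s. pip (velocity I c s) (fieldX (c s))) constant_on I"
    by (simp_all add: \<alpha>_def \<beta>_def v_def)
qed

section \<open>An explicit geodesic: an orbit of T on a circle in a negative definite plane\<close>

lemma circle_geodesic: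
  fixes I :: "real set"
  assumes I: "is_interval I" "interior I \<noteq> {}"
  defines "c \<equiv> (\<lambda>s. vector [cos s, sin s, 0, 0] :: real^4)"
  shows "c \<in> horizontal_timelike_fd_curves I" "geodesic_with_multiplier I (\<lambda>_. 0) c"
proof -
  \<comment> \<open>Differentiating cos or sin advances the phase by a quarter period, so one
    formula covers all orders k.\<close>
  define D where "D = (\<lambda>(k::nat) s. vector [cos (s + k * (pi/2)), sin (s + k * (pi/2)), 0, 0] :: real^4)"
  have dD: "(D k has_vector_derivative D (Suc k) s) (at s within I)" for k s
  proof -
    have shift: "s + real (Suc k) * (pi/2) = (s + k * (pi/2)) + pi/2"
      by (simp add: algebra_simps)
    have basis: "D j t = cos (t + j * (pi/2)) *\<^sub>R axis 1 1 + sin (t + j * (pi/2)) *\<^sub>R axis 2 1" for j t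
      by (simp add: D_def vec_eq_iff forall_4 axis_def)
    show ?thesis
      unfolding basis shift cos_add[of _ "pi/2"] sin_add[of _ "pi/2"]
      by (auto intro!: derivative_eq_intros simp: algebra_simps)
  qed
  have D0: "D 0 = c" by (simp add: D_def c_def)
  have vel: "velocity I c s = fieldT (c s)" if "s \<in> I" for s
  proof -
    have "D 1 s = fieldT (c s)"
      by (simp add: D_def c_def fieldT_def vec_eq_iff forall_4 cos_add sin_add)
    then show ?thesis
      using velocity_eqI[OF I that] dD[of 0 s] D0 by simp
  qed
  have cA: "c s \<in> AdS" for s
    using sin_cos_squared_add[of s] by (simp add: c_def AdS_def pip_def power2_eq_square)
  have smooth: "smooth_curve I c"
    unfolding smooth_curve_def using D0 dD by blast
  have "c differentiable_on I"
    unfolding differentiable_on_def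
    using dD[of 0] D0 differentiableI_vector by metis
  then have curve: "AdS_curve I c"
    using cA by (auto simp: AdS_curve_def)
  have hor: "horizontal I c"
    by (auto simp: horizontal_def vel intro: span_base)
  show "c \<in> horizontal_timelike_fd_curves I"
    using cA curve hor
    by (auto simp: horizontal_timelike_fd_curves_def timelike_def future_directed_def vel
        pip_frame AdS_def)
  have "euler_lagrange_AdS I (lagrangian (\<lambda>_. 0)) c"
    unfolding euler_lagrange_AdS_def
  proof (intro ballI)
    fix s w assume s: "s \<in> I" and w: "w \<in> AdS_tangent (c s)"
    have norm: "pip (c t) (c t) = -1" for t using cA[of t] by (simp add: AdS_def)
    \<comment> \<open>The velocity is T(c), so \<alpha> = -1 and \<beta> = 0, and only the T term
      remains.\<close>
    have momentum: "frechet_derivative (\<lambda>v. lagrangian (\<lambda>_. 0) t (c t) v) (at (velocity I c t)) w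
        = pip w (fieldT (c t))" if "t \<in> I" for t
      using vel[OF that] norm
      by (simp add: frechet_derivative_lagrangian_velocity pip_frame)
    \<comment> \<open>The remaining term <T(c), T(w)> equals <c, w>, which is zero because w is
      tangent to AdS.\<close>
    have force: "frechet_derivative (\<lambda>x. lagrangian (\<lambda>_. 0) s x (velocity I c s)) (at (c s)) w = 0"
      using vel[OF s] w
      by (simp add: frechet_derivative_lagrangian_position pip_frame norm pip_field_skew(1)
          field_compositions pip_simps AdS_tangent_def)
    have "(c has_vector_derivative fieldT (c s)) (at s within I)"
      using dD[of 0 s] D0
      by (simp add: D_def c_def fieldT_def cos_add sin_add)
    from bounded_linear.has_vector_derivative[OF
        bounded_bilinear.bounded_linear_right[OF bounded_bilinear_pip, of w]
        bounded_linear.has_vector_derivative[OF bounded_linear_fieldT this]]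
    \<comment> \<open>T applied twice is -1, so the derivative is -<w, c>, again zero by
      tangency.\<close>
    have "((\<lambda>t. pip w (fieldT (c t))) has_real_derivative 0) (at s within I)"
      using w by (simp add: has_real_derivative_iff_has_vector_derivative field_compositions
          pip_simps AdS_tangent_def pip_commute)
    \<comment> \<open>\<open>momentum\<close> is available throughout I, so any positive radius,
      here 1, serves to transfer the derivative.\<close>
    then show "((\<lambda>t. frechet_derivative (\<lambda>v. lagrangian (\<lambda>_. 0) t (c t) v) (at (velocity I c t)) w)
        has_real_derivative
        frechet_derivative (\<lambda>x. lagrangian (\<lambda>_. 0) s x (velocity I c s)) (at (c s)) w)
        (at s within I)"
      unfolding force
      by (rule has_field_derivative_transform_within[OF _ zero_less_one s])
         (simp add: momentum)
  qed
  then show "geodesic_with_multiplier I (\<lambda>_. 0) c"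
    using smooth curve hor by (simp add: geodesic_with_multiplier_def)
qed

section \<open>Existence and invariants of the geodesics with zero multiplier\<close>

theorem theorem3:
  fixes I :: "real set"
  assumes "is_interval I" and "interior I \<noteq> {}"
  shows "(\<exists>c \<in> horizontal_timelike_fd_curves I. geodesic_with_multiplier I (\<lambda>_. 0) c) \<and>
    (\<forall>c \<in> horizontal_timelike_fd_curves I. geodesic_with_multiplier I (\<lambda>_. 0) c \<longrightarrow>
       (\<lambda>s. pnorm (velocity I c s)) constant_on I \<and>
       (\<lambda>s. pip (fieldT (c s)) (velocity I c s)) constant_on I \<and>
       (\<lambda>s. pip (fieldX (c s)) (velocity I c s)) constant_on I \<and>
       (\<forall>s\<in>I. pip (fieldY (c s)) (velocity I c s) = 0) \<and>
       (\<exists>\<theta>. \<forall>s\<in>I. is_hyperbolic_angle (fieldT (c s)) (velocity I c s) \<theta> \<and>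
                 hyperbolic_angle (fieldT (c s)) (velocity I c s) = \<theta>))"
proof (intro conjI ballI impI)
  show "\<exists>c \<in> horizontal_timelike_fd_curves I. geodesic_with_multiplier I (\<lambda>_. 0) c"
    using circle_geodesic[OF assms] by blast
next
  fix c assume c: "c \<in> horizontal_timelike_fd_curves I"
    and geo: "geodesic_with_multiplier I (\<lambda>_. 0) c"
  define v where "v = velocity I c"
  have cA: "c s \<in> AdS" and hor: "v s \<in> span {fieldT (c s), fieldX (c s)}"
    and tl: "pip (v s) (v s) < 0" and fd: "pip (v s) (fieldT (c s)) < 0" if "s \<in> I" for s
    using c that by (auto simp: horizontal_timelike_fd_curves_def AdS_curve_def horizontal_def
        timelike_def future_directed_def v_def)
  obtain a b where a: "\<And>s. s \<in> I \<Longrightarrow> pip (v s) (fieldT (c s)) = a"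
    and b: "\<And>s. s \<in> I \<Longrightarrow> pip (v s) (fieldX (c s)) = b"
    using geodesic_inner_products_constant[OF assms geo] by (auto simp: constant_on_def v_def)
  have norm: "pnorm (v s) = sqrt \<bar>- a\<^sup>2 + b\<^sup>2\<bar>" if "s \<in> I" for s
    using horizontal_vector_pip(3)[OF cA hor] that by (simp add: pnorm_def a b)
  then show "(\<lambda>s. pnorm (velocity I c s)) constant_on I"
    by (auto simp: constant_on_def v_def)
  show "(\<lambda>s. pip (fieldT (c s)) (velocity I c s)) constant_on I"
    "(\<lambda>s. pip (fieldX (c s)) (velocity I c s)) constant_on I"
    using a b by (auto simp: constant_on_def v_def pip_commute)
  show "pip (fieldY (c s)) (velocity I c s) = 0" if "s \<in> I" for s
    using horizontal_vector_pip(2)[OF cA hor] that by (simp add: v_def)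
  \<comment> \<open>The condition defining the angle is expressed by the constants a and b alone, so
    its right-hand side is independent of s and an angle found at one base point serves
    everywhere.\<close>
  have angle_iff: "is_hyperbolic_angle (fieldT (c s)) (v s) \<theta> \<longleftrightarrow>
      \<theta> \<ge> 0 \<and> a = - sqrt \<bar>- a\<^sup>2 + b\<^sup>2\<bar> * cosh \<theta>" if s: "s \<in> I" for s \<theta>
  proof -
    have TT: "pip (fieldT (c s)) (fieldT (c s)) = -1"
      using cA[OF s] by (simp add: pip_frame AdS_def)
    have Tv: "pip (fieldT (c s)) (v s) = a" "a < 0"
      using a[OF s] fd[OF s] by (simp_all add: pip_commute)
    show ?thesis
      by (simp add: is_hyperbolic_angle_def TT Tv tl[OF s] norm[OF s] pnorm_def[of "fieldT (c s)"])
  qed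
  obtain s0 where s0: "s0 \<in> I" using assms(2) interior_subset by blast
  obtain \<theta> where \<theta>: "is_hyperbolic_angle (fieldT (c s0)) (v s0) \<theta>"
    using hyperbolic_angle_fieldT[OF cA hor tl fd] s0 by blast
  have "is_hyperbolic_angle (fieldT (c s)) (v s) \<theta>" if "s \<in> I" for s
    using \<theta> angle_iff[OF s0] angle_iff[OF that] by blast
  \<comment> \<open>\<open>hyperbolic_angle\<close> is a definite description, so identifying its
    value takes uniqueness at each s as well.\<close>
  moreover from this have "hyperbolic_angle (fieldT (c s)) (v s) = \<theta>" if "s \<in> I" for s
    unfolding hyperbolic_angle_def
    using hyperbolic_angle_fieldT[OF cA hor tl fd] that by (intro the1_equality) blast+
  ultimately show "\<exists>\<theta>. \<forall>s\<in>I. is_hyperbolic_angle (fieldT (c s)) (velocity I c s) \<theta> \<and>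
      hyperbolic_angle (fieldT (c s)) (velocity I c s) = \<theta>"
    by (auto simp: v_def)
qed

end
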